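(* Assume that $\mathcal{X}\subseteq\mathbb{R}^d$ and $\Xi\subseteq\mathbb{R}^k$ are compact and bounded, that $h$ is bounded on $\mathcal{X}\times\Xi$, and that for every $\mathbf{x}\in\mathcal{X}$ there is a constant $c_p>0$ such that $|h(\mathbf{x},s_1)-h(\mathbf{x},s_2)|\le c_p\|s_1-s_2\|_p$ for all $s_1,s_2\in\Xi$. Let $\hat P_N(\mathbf{x})=\sum_{i=1}^{N_\xi}f_i(\mathbf{x})\,\delta_{\xi_{m_i}}$, $\mathbf{x}\in\mathcal{X}$, be an interpolation of the empirical measures of the dataset $\mathcal{D}$, let $r_N>0$, and let $\mathcal{P}(\mathbf{x})=\{P\in\mathcal{M}(\Xi,\mathcal{B}(\Xi)) : d_W(P,\hat P_N(\mathbf{x}))\le r_N\}$. Then the problem $$\min_{\mathbf{x}\in\mathcal{X}}\ \max_{P\in\mathcal{P}(\mathbf{x})}\ \mathbb{E}_P[h(\mathbf{x},\xi)]$$ is equivalent to the semi-infinite optimization problem $$\begin{aligned}\min_{\mathbf{x}\in\mathcal{X},\ \nu\in\mathbb{R}^{N_\xi+1}}\quad & \sum_{i=1}^{N_\xi}f_i(\mathbf{x})\,\nu_i+r_N\,\nu_{N_\xi+1}\\ \text{s.t.}\quad & h(\mathbf{x},s)-\nu_i-\nu_{N_\xi+1}\,\|s-\xi_{m_i}\|_p\le 0\quad \forall s\in\Xi,\ \forall i\in[N_\xi],\\ & \nu_1,\dots,\nu_{N_\xi}\in\mathbb{R},\ \nu_{N_\xi+1}\ge 0,\end{aligned}$$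 that is, the two problems have the same optimal value, and $\mathbf{x}\in\mathcal{X}$ is an optimal solution of the first if and only if there is $\nu$ such that $(\mathbf{x},\nu)$ is an optimal solution of the second.
   Context: Setting. $\mathcal{X}\subseteq\mathbb{R}^d$ is the (nonempty) set of feasible decisions, equipped with a metric $d_{\mathcal{X}}$; $\Xi\subseteq\mathbb{R}^k$ is the set of values of the random parameter $\xi$; $h:\mathbb{R}^d\times\mathbb{R}^k\to\mathbb{R}\cup\{\pm\infty\}$ is the objective function. $\mathcal{M}(\Xi,\mathcal{B}(\Xi))$ is the set of all Borel probability measures on $\Xi$. Optimal values are understood as infima over minimization variables and suprema over $P$; an optimal solution is a feasible point attaining the optimal value. Wasserstein distance. Fix $p\ge1$. For $P_1,P_2\in\mathcal{M}(\Xi,\mathcal{B}(\Xi))$, $d_W(P_1,P_2)=\inf_{\gamma}\int_{\Xi\times\Xi}\|s_1-s_2\|_p\,\gamma(ds_1\times ds_2)$, the infimum being over all couplings $\gamma$ of $P_1$ and $P_2$. Data. The dataset is $\mathcal{D}=\{(\mathbf{x}_n,\xi_n)\}_{n\in[N]}$ with $\mathbf{x}_n\in\mathcal{X}$, $\xi_n\in\Xi$, $[N]=\{1,\dots,N\}$. Let $\{\mathbf{x}_{n_i}\}_{i\in[N_{\mathbf{x}}]}$ be the distinct values among the $\mathbf{x}_n$ and $\{\xi_{m_i}\}_{i\in[N_\xi]}$ the distinct values among the $\xi_n$. Let $N_i=\#\{n\in[N]:\mathbf{x}_n=\mathbf{x}_{n_i}\}$, and let $\mu_i=\frac1{N_i}\sum_{n:\,\mathbf{x}_n=\mathbf{x}_{n_i}}\delta_{\xi_n}$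 be the empirical measure at $\mathbf{x}_{n_i}$ ($\delta$ denotes a Dirac measure). Interpolation. An interpolation of the empirical measures is a family $\hat P_N(\mathbf{x})=\sum_{i=1}^{N_{\mathbf{x}}}\omega_i(\mathbf{x})\mu_i$, $\mathbf{x}\in\mathcal{X}$, with weights satisfying $\omega_i(\mathbf{x})\ge0$ for all $i$ and $\mathbf{x}$, $\sum_{i=1}^{N_{\mathbf{x}}}\omega_i(\mathbf{x})=1$ for all $\mathbf{x}$, and $\omega_i(\mathbf{x}_{n_i})=1$ for all $i$, and for which there is a constant $c_1\ge0$ such that for every $\mathbf{x}\in\mathcal{X}$ there is an index $i$ with $d_{\mathcal{X}}(\mathbf{x},\mathbf{x}_{n_i})=\min_{j\in[N_{\mathbf{x}}]}d_{\mathcal{X}}(\mathbf{x},\mathbf{x}_{n_j})$ and $d_W(\hat P_N(\mathbf{x}),\hat P_N(\mathbf{x}_{n_i}))\le c_1\min_{j\in[N_{\mathbf{x}}]}d_{\mathcal{X}}(\mathbf{x},\mathbf{x}_{n_j})$. Such a family can be written as $\hat P_N(\mathbf{x})=\sum_{i=1}^{N_\xi}f_i(\mathbf{x})\delta_{\xi_{m_i}}$, where $$f_i(\mathbf{x})=\sum_{n=1}^N\mathbf{1}[\xi_n=\xi_{m_i}]\sum_{j=1}^{N_{\mathbf{x}}}\frac{\omega_j(\mathbf{x})}{N_j}\mathbf{1}[\mathbf{x}_n=\mathbf{x}_{n_j}],\qquad \sum_{i=1}^{N_\xi}f_i(\mathbf{x})=1 .$$ *)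

theory Defs
  imports "HOL-Probability.Probability"
begin

definition p_norm :: "real \<Rightarrow> real ^ 'k \<Rightarrow> real" where
  "p_norm p v = (\<Sum>i\<in>UNIV. \<bar>v $ i\<bar> powr p) powr (1 / p)"

definition borel_on :: "'a::topological_space set \<Rightarrow> 'a measure" where
  "borel_on \<Xi> = restrict_space borel \<Xi>"

definition borel_probs :: "'a::topological_space set \<Rightarrow> 'a measure set" where
  "borel_probs \<Xi> = {P. sets P = sets (borel_on \<Xi>) \<and> prob_space P}"

definition couplings ::
  "'a::topological_space set \<Rightarrow> 'a measure \<Rightarrow> 'a measure \<Rightarrow> ('a \<times> 'a) measure set" where
  "couplings \<Xi> P1 P2 = {\<gamma>. sets \<gamma> = sets (borel_on \<Xi> \<Otimes>\<^sub>M borel_on \<Xi>) \<and> prob_space \<gamma>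
      \<and> distr \<gamma> (borel_on \<Xi>) fst = P1 \<and> distr \<gamma> (borel_on \<Xi>) snd = P2}"

definition wasserstein ::
  "real \<Rightarrow> (real ^ 'k) set \<Rightarrow> (real ^ 'k) measure \<Rightarrow> (real ^ 'k) measure \<Rightarrow> ennreal" where
  "wasserstein p \<Xi> P1 P2 =
     (INF \<gamma>\<in>couplings \<Xi> P1 P2. \<integral>\<^sup>+ z. ennreal (p_norm p (fst z - snd z)) \<partial>\<gamma>)"

text \<open>The weighted sum of the measures \<open>m i\<close>, \<open>i \<in> I\<close>, on the Borel sets of \<open>\<Xi>\<close>;
  the weights are meant to be nonnegative (negative ones would be truncated to 0).\<close>

definition mixture ::
  "'a::topological_space set \<Rightarrow> 'i set \<Rightarrow> ('i \<Rightarrow> real) \<Rightarrow> ('i \<Rightarrow> 'a measure) \<Rightarrow> 'a measure" where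
  "mixture \<Xi> I w m =
     measure_of \<Xi> (sets (borel_on \<Xi>)) (\<lambda>A. \<Sum>i\<in>I. ennreal (w i) * emeasure (m i) A)"

text \<open>Data points are indexed by \<open>{1..N}\<close>. In \<open>distinct_values N z K e\<close> the map \<open>e\<close> picks
  indices \<open>e 1, \<dots>, e K\<close> such that \<open>z (e 1), \<dots>, z (e K)\<close> lists every value among
  \<open>z 1, \<dots>, z N\<close> exactly once.\<close>

definition distinct_values :: "nat \<Rightarrow> (nat \<Rightarrow> 'a) \<Rightarrow> nat \<Rightarrow> (nat \<Rightarrow> nat) \<Rightarrow> bool" where
  "distinct_values N z K e \<longleftrightarrow>
     e ` {1..K} \<subseteq> {1..N} \<and> bij_betw (\<lambda>i. z (e i)) {1..K} (z ` {1..N})"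

definition obs_at :: "nat \<Rightarrow> (nat \<Rightarrow> 'x) \<Rightarrow> 'x \<Rightarrow> nat set" where
  "obs_at N xs y = {n \<in> {1..N}. xs n = y}"

definition empirical ::
  "'a::topological_space set \<Rightarrow> nat \<Rightarrow> (nat \<Rightarrow> 'x) \<Rightarrow> (nat \<Rightarrow> 'a) \<Rightarrow> 'x \<Rightarrow> 'a measure" where
  "empirical \<Xi> N xs \<xi> y =
     mixture \<Xi> (obs_at N xs y) (\<lambda>_. 1 / real (card (obs_at N xs y)))
       (\<lambda>n. return (borel_on \<Xi>) (\<xi> n))"

definition interp ::
  "'a::topological_space set \<Rightarrow> nat \<Rightarrow> (nat \<Rightarrow> 'x) \<Rightarrow> (nat \<Rightarrow> 'a) \<Rightarrow> nat \<Rightarrow> (nat \<Rightarrow> nat)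
     \<Rightarrow> (nat \<Rightarrow> 'x \<Rightarrow> real) \<Rightarrow> 'x \<Rightarrow> 'a measure" where
  "interp \<Xi> N xs \<xi> Nx nx \<omega> x =
     mixture \<Xi> {1..Nx} (\<lambda>i. \<omega> i x) (\<lambda>i. empirical \<Xi> N xs \<xi> (xs (nx i)))"

definition nearest_dist ::
  "('x \<Rightarrow> 'x \<Rightarrow> real) \<Rightarrow> (nat \<Rightarrow> 'x) \<Rightarrow> nat \<Rightarrow> (nat \<Rightarrow> nat) \<Rightarrow> 'x \<Rightarrow> real" where
  "nearest_dist dX xs Nx nx x = Min ((\<lambda>j. dX x (xs (nx j))) ` {1..Nx})"

definition is_interpolation ::
  "'x set \<Rightarrow> ('x \<Rightarrow> 'x \<Rightarrow> real) \<Rightarrow> real \<Rightarrow> (real ^ 'k) set \<Rightarrow> nat \<Rightarrow> (nat \<Rightarrow> 'x)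
     \<Rightarrow> (nat \<Rightarrow> real ^ 'k) \<Rightarrow> nat \<Rightarrow> (nat \<Rightarrow> nat) \<Rightarrow> (nat \<Rightarrow> 'x \<Rightarrow> real) \<Rightarrow> bool" where
  "is_interpolation X dX p \<Xi> N xs \<xi> Nx nx \<omega> \<longleftrightarrow>
     (\<forall>x\<in>X. \<forall>i\<in>{1..Nx}. 0 \<le> \<omega> i x) \<and>
     (\<forall>x\<in>X. (\<Sum>i=1..Nx. \<omega> i x) = 1) \<and>
     (\<forall>i\<in>{1..Nx}. \<omega> i (xs (nx i)) = 1) \<and>
     (\<exists>c1\<ge>0. \<forall>x\<in>X. \<exists>i\<in>{1..Nx}.
        dX x (xs (nx i)) = nearest_dist dX xs Nx nx x \<and>
        wasserstein p \<Xi> (interp \<Xi> N xs \<xi> Nx nx \<omega> x) (interp \<Xi> N xs \<xi> Nx nx \<omega> (xs (nx i)))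
          \<le> ennreal (c1 * nearest_dist dX xs Nx nx x))"

definition interp_coeff ::
  "nat \<Rightarrow> (nat \<Rightarrow> 'x) \<Rightarrow> (nat \<Rightarrow> 'a) \<Rightarrow> nat \<Rightarrow> (nat \<Rightarrow> nat) \<Rightarrow> (nat \<Rightarrow> nat)
     \<Rightarrow> (nat \<Rightarrow> 'x \<Rightarrow> real) \<Rightarrow> nat \<Rightarrow> 'x \<Rightarrow> real" where
  "interp_coeff N xs \<xi> Nx nx m\<xi> \<omega> i x =
     (\<Sum>n=1..N. of_bool (\<xi> n = \<xi> (m\<xi> i)) *
        (\<Sum>j=1..Nx. \<omega> j x / real (card (obs_at N xs (xs (nx j)))) * of_bool (xs n = xs (nx j))))"

definition opt_value :: "'z set \<Rightarrow> ('z \<Rightarrow> ereal) \<Rightarrow> ereal" where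
  "opt_value F J = (INF z\<in>F. J z)"

definition optimal_solution :: "'z set \<Rightarrow> ('z \<Rightarrow> ereal) \<Rightarrow> 'z \<Rightarrow> bool" where
  "optimal_solution F J z \<longleftrightarrow> z \<in> F \<and> J z = opt_value F J"

definition ambiguity ::
  "real \<Rightarrow> (real ^ 'k) set \<Rightarrow> real \<Rightarrow> (real ^ 'k) measure \<Rightarrow> (real ^ 'k) measure set" where
  "ambiguity p \<Xi> r Q = {P \<in> borel_probs \<Xi>. wasserstein p \<Xi> P Q \<le> ennreal r}"

text \<open>The expectation is the Bochner integral of the real part of \<open>h\<close>: it is the usual expectation
  because \<open>h\<close> is assumed bounded, hence finite, on \<open>X \<times> \<Xi>\<close>.\<close>

definition worst_case ::
  "('x \<Rightarrow> 'a \<Rightarrow> ereal) \<Rightarrow> ('x \<Rightarrow> 'a measure set) \<Rightarrow> 'x \<Rightarrow> ereal" where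
  "worst_case h \<P> x = (SUP P\<in>\<P> x. ereal (\<integral>s. real_of_ereal (h x s) \<partial>P))"

text \<open>Vectors \<open>\<nu>\<close> with \<open>N\<xi> + 1\<close> real entries are extensional functions on \<open>{1..N\<xi> + 1}\<close>.\<close>

definition sip_feasible ::
  "real \<Rightarrow> 'x set \<Rightarrow> (real ^ 'k) set \<Rightarrow> ('x \<Rightarrow> real ^ 'k \<Rightarrow> ereal) \<Rightarrow> (nat \<Rightarrow> real ^ 'k)
     \<Rightarrow> nat \<Rightarrow> (nat \<Rightarrow> nat) \<Rightarrow> ('x \<times> (nat \<Rightarrow> real)) set" where
  "sip_feasible p X \<Xi> h \<xi> N\<xi> m\<xi> =
     {(x, \<nu>). x \<in> X \<and> \<nu> \<in> {1..N\<xi> + 1} \<rightarrow>\<^sub>E UNIV \<and>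
        (\<forall>s\<in>\<Xi>. \<forall>i\<in>{1..N\<xi>}.
           h x s - ereal (\<nu> i) - ereal (\<nu> (N\<xi> + 1) * p_norm p (s - \<xi> (m\<xi> i))) \<le> 0) \<and>
        0 \<le> \<nu> (N\<xi> + 1)}"

definition sip_objective ::
  "(nat \<Rightarrow> 'x \<Rightarrow> real) \<Rightarrow> real \<Rightarrow> nat \<Rightarrow> 'x \<times> (nat \<Rightarrow> real) \<Rightarrow> ereal" where
  "sip_objective f r N\<xi> = (\<lambda>(x, \<nu>). ereal ((\<Sum>i=1..N\<xi>. f i x * \<nu> i) + r * \<nu> (N\<xi> + 1)))"

end

theory Submission
  imports Defs
begin

text \<open>
  The semi-infinite problem is a Lagrangian dual of the inner maximization, and the equivalence is
  strong duality for each \<open>x\<close> separately. Fix \<open>x\<close>, write \<open>g = h x\<close>, and let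
  \<open>Q = (\<Sum>i. w i * \<delta> (a i))\<close> be the interpolated measure at \<open>x\<close>. For a multiplier
  \<open>l \<ge> 0\<close> of the constraint that the transport cost is at most \<open>r\<close>, the cheapest feasible
  \<open>\<nu> i\<close> is the supremum over \<open>s\<close> of \<open>g s - l * p_norm p (s - a i)\<close>. So minimizing over \<open>\<nu>\<close> leaves
  a function \<open>\<phi>\<close> of the single real variable \<open>l\<close>, namely \<open>r * l\<close> plus the \<open>w\<close>-average of these
  suprema.

  Weak duality (\<open>expectation_le_dual\<close>): the constraints say that
  \<open>g s \<le> \<nu> i + l * p_norm p (s - a i)\<close>; integrating this over a nearly optimal coupling of \<open>P\<close>
  and \<open>Q\<close> bounds the expectation of \<open>g\<close> by the dual objective.

  Strong duality (\<open>worst_case_strong_duality\<close>): \<open>\<phi>\<close> is continuous and grows at least linearly with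
  slope \<open>r > 0\<close>, so it has a minimizer \<open>l\<close>. Transport each atom \<open>a i\<close> to a maximizer of the penalized
  objective for a multiplier slightly above \<open>l\<close>, or slightly below it. Since \<open>\<phi>\<close> does not fall when
  moving away from \<open>l\<close>, the first plan costs at most \<open>r\<close> and the second at least \<open>r\<close>; a convex
  combination costs exactly \<open>r\<close> and has expectation arbitrarily close to \<open>\<phi> l\<close>
  (\<open>dual_approx_attained\<close>). The dual minimum is attained for every \<open>x\<close>; for the supremum over \<open>P\<close>,
  approximation is enough.

  Attainment for every \<open>x\<close> turns equality of the inner values into equivalence of the two outer
  problems, solutions included (\<open>partial_minimization_equivalence\<close>).
\<close>

section \<open>Lagrangian duality in one multiplier\<close>

definition penalized_sup :: "'a set \<Rightarrow> ('a \<Rightarrow> real) \<Rightarrow> ('a \<Rightarrow> real) \<Rightarrow> real \<Rightarrow> real" where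
  "penalized_sup S g c l = (SUP s\<in>S. g s - l * c s)"

lemma penalized_sup_attained:
  fixes g c :: "'a::topological_space \<Rightarrow> real"
  assumes "compact S" "S \<noteq> {}" "continuous_on S g" "continuous_on S c"
  obtains s where "s \<in> S" "penalized_sup S g c l = g s - l * c s"
proof -
  have "continuous_on S (\<lambda>s. g s - l * c s)"
    using assms by (intro continuous_intros)
  then obtain s where s: "s \<in> S" "\<And>t. t \<in> S \<Longrightarrow> g t - l * c t \<le> g s - l * c s"
    using continuous_attains_sup[OF assms(1,2)] by blast
  then have "penalized_sup S g c l = g s - l * c s"
    unfolding penalized_sup_def by (intro cSup_eq_maximum) auto
  then show thesis using that s by blast
qed

lemma penalized_sup_upper:
  fixes g c :: "'a::topological_space \<Rightarrow> real"
  assumes "compact S" "continuous_on S g" "continuous_on S c" "s \<in> S"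
  shows "g s - l * c s \<le> penalized_sup S g c l"
proof -
  have "continuous_on S (\<lambda>s. g s - l * c s)"
    using assms by (intro continuous_intros)
  then have "compact ((\<lambda>s. g s - l * c s) ` S)"
    using assms(1) compact_continuous_image by blast
  then have "bdd_above ((\<lambda>s. g s - l * c s) ` S)"
    by (simp add: bounded_imp_bdd_above compact_imp_bounded)
  then show ?thesis
    unfolding penalized_sup_def using assms(4) by (intro cSUP_upper)
qed

text \<open>Each function of \<open>l\<close> under the supremum is affine with slope \<open>- c s\<close>, and \<open>c\<close> is bounded on the
  compact set \<open>S\<close>; a supremum of uniformly Lipschitz functions is Lipschitz.\<close>

lemma continuous_on_penalized_sup:
  fixes g c :: "'a::topological_space \<Rightarrow> real"
  assumes "compact S" "S \<noteq> {}" "continuous_on S g" "continuous_on S c"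
  shows "continuous_on T (penalized_sup S g c)"
proof -
  obtain C where C: "\<And>s. s \<in> S \<Longrightarrow> \<bar>c s\<bar> \<le> C"
    using compact_imp_bounded[OF compact_continuous_image[OF assms(4,1)]]
    unfolding bounded_iff by auto
  have le: "penalized_sup S g c l \<le> penalized_sup S g c l' + C * \<bar>l - l'\<bar>" for l l'
  proof -
    obtain s where s: "s \<in> S" "penalized_sup S g c l = g s - l * c s"
      using penalized_sup_attained[OF assms] .
    have "(l' - l) * c s \<le> \<bar>l' - l\<bar> * \<bar>c s\<bar>"
      by (metis abs_ge_self abs_mult)
    also have "\<dots> \<le> \<bar>l' - l\<bar> * C"
      using C[OF s(1)] by (intro mult_left_mono) auto
    finally show ?thesis
      using penalized_sup_upper[OF assms(1,3,4) s(1), of l'] s(2)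
      by (simp add: algebra_simps abs_minus_commute)
  qed
  have "C-lipschitz_on T (penalized_sup S g c)"
  proof (rule lipschitz_onI)
    show "0 \<le> C" using C assms(2) by fastforce
    show "dist (penalized_sup S g c l) (penalized_sup S g c l') \<le> C * dist l l'" for l l'
      using le[of l l'] le[of l' l] by (simp add: dist_real_def abs_minus_commute)
  qed
  then show ?thesis by (rule lipschitz_on_continuous_on)
qed

definition dual_fun ::
  "'a set \<Rightarrow> ('a \<Rightarrow> real) \<Rightarrow> ('i \<Rightarrow> 'a \<Rightarrow> real) \<Rightarrow> 'i set \<Rightarrow> ('i \<Rightarrow> real) \<Rightarrow> real \<Rightarrow> real \<Rightarrow> real" where
  "dual_fun S g c I w r l = r * l + (\<Sum>i\<in>I. w i * penalized_sup S g (c i) l)"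

text \<open>Moving mass from the \<open>i\<close>-th atom, which has weight \<open>w i\<close>, to the point \<open>s\<close> costs
  \<open>c i s\<close>, and not moving it is free: this is the assumption \<open>c_zero\<close>. The total budget is \<open>r\<close>.\<close>

locale transport_dual =
  fixes S :: "'a::topological_space set" and g :: "'a \<Rightarrow> real"
    and c :: "'i \<Rightarrow> 'a \<Rightarrow> real" and I :: "'i set" and w :: "'i \<Rightarrow> real" and r :: real
  assumes compact_S: "compact S" and S_ne: "S \<noteq> {}"
    and cont_g: "continuous_on S g" and cont_c: "\<And>i. i \<in> I \<Longrightarrow> continuous_on S (c i)"
    and c_nonneg: "\<And>i s. i \<in> I \<Longrightarrow> s \<in> S \<Longrightarrow> 0 \<le> c i s"
    and c_zero: "\<And>i. i \<in> I \<Longrightarrow> \<exists>s\<in>S. c i s = 0"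
    and w_nonneg: "\<And>i. i \<in> I \<Longrightarrow> 0 \<le> w i"
    and r_pos: "0 < r"
begin

abbreviation "\<phi> \<equiv> dual_fun S g c I w r"

text \<open>Leaving all mass where it costs nothing shows \<open>\<phi> l \<ge> r * l + b\<close> with a constant \<open>b\<close>. Hence
  beyond a point \<open>L\<close> the values of \<open>\<phi>\<close> exceed \<open>\<phi> 0\<close>, and the minimum over a compact interval is
  global.\<close>

lemma dual_minimizer:
  "\<exists>l\<ge>0. \<forall>l'\<ge>0. \<phi> l \<le> \<phi> l'"
proof -
  obtain a where a: "\<And>i. i \<in> I \<Longrightarrow> a i \<in> S \<and> c i (a i) = 0"
    using c_zero by metis
  define b where "b = (\<Sum>i\<in>I. w i * g (a i))"
  have lower: "r * l + b \<le> \<phi> l" for l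
  proof -
    have "g (a i) \<le> penalized_sup S g (c i) l" if "i \<in> I" for i
      using penalized_sup_upper[OF compact_S cont_g cont_c[OF that], of "a i" l] a[OF that] by simp
    then show ?thesis
      unfolding dual_fun_def b_def
      by (intro add_mono sum_mono mult_left_mono order_refl w_nonneg) auto
  qed
  define L where "L = (\<phi> 0 - b) / r"
  have L: "0 \<le> L"
    using lower[of 0] r_pos unfolding L_def by simp
  have "continuous_on {0..L} \<phi>"
    unfolding dual_fun_def
    by (intro continuous_intros continuous_on_penalized_sup compact_S S_ne cont_g cont_c)
  then obtain l where l: "l \<in> {0..L}" "\<And>l'. l' \<in> {0..L} \<Longrightarrow> \<phi> l \<le> \<phi> l'"
    using continuous_attains_inf[of "{0..L}" \<phi>] L by auto
  have "\<phi> l \<le> \<phi> l'" if "0 \<le> l'" for l'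
  proof (cases "l' \<le> L")
    case False
    have "\<phi> l \<le> \<phi> 0" using l(2)[of 0] L by simp
    also have "\<dots> = r * L + b" unfolding L_def using r_pos by simp
    also have "\<dots> \<le> r * l' + b" using False r_pos by simp
    also have "\<dots> \<le> \<phi> l'" by (rule lower)
    finally show ?thesis .
  qed (use that l(2) in auto)
  then show ?thesis using l(1) by auto
qed

text \<open>The penalized maximizers \<open>s\<close> at \<open>l\<close> give an affine function that touches \<open>\<phi>\<close> from below at
  \<open>l\<close>, a subgradient with slope \<open>r\<close> minus the cost of the plan \<open>s\<close>.\<close>

lemma dual_maximizers:
  "\<exists>s. (\<forall>i\<in>I. s i \<in> S)
    \<and> \<phi> l = r * l + (\<Sum>i\<in>I. w i * g (s i)) - l * (\<Sum>i\<in>I. w i * c i (s i))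
    \<and> (\<forall>l'. r * l' + (\<Sum>i\<in>I. w i * g (s i)) - l' * (\<Sum>i\<in>I. w i * c i (s i)) \<le> \<phi> l')"
proof -
  have "\<exists>s. s \<in> S \<and> penalized_sup S g (c i) l = g s - l * c i s" if "i \<in> I" for i
    using penalized_sup_attained[OF compact_S S_ne cont_g cont_c[OF that]] by metis
  then obtain s where s: "\<And>i. i \<in> I \<Longrightarrow> s i \<in> S"
      "\<And>i. i \<in> I \<Longrightarrow> penalized_sup S g (c i) l = g (s i) - l * c i (s i)"
    by metis
  have split: "(\<Sum>i\<in>I. w i * (g (s i) - l' * c i (s i)))
      = (\<Sum>i\<in>I. w i * g (s i)) - l' * (\<Sum>i\<in>I. w i * c i (s i))" for l'
    by (simp add: right_diff_distrib sum_subtractf sum_distrib_left mult_ac)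
  show ?thesis
  proof (intro exI[of _ s] conjI ballI allI)
    show "s i \<in> S" if "i \<in> I" for i using s(1)[OF that] .
    show "\<phi> l = r * l + (\<Sum>i\<in>I. w i * g (s i)) - l * (\<Sum>i\<in>I. w i * c i (s i))"
      using split[of l] s(2) unfolding dual_fun_def by simp
    show "r * l' + (\<Sum>i\<in>I. w i * g (s i)) - l' * (\<Sum>i\<in>I. w i * c i (s i)) \<le> \<phi> l'" for l'
    proof -
      have "(\<Sum>i\<in>I. w i * (g (s i) - l' * c i (s i))) \<le> (\<Sum>i\<in>I. w i * penalized_sup S g (c i) l')"
        using s(1) w_nonneg
        by (intro sum_mono mult_left_mono penalized_sup_upper compact_S cont_g cont_c)
      then show ?thesis using split[of l'] unfolding dual_fun_def by simp
    qed
  qed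
qed

text \<open>Subgradients of \<open>\<phi>\<close> just right and just left of a minimizer \<open>l\<close> are nonnegative and nonpositive,
  so the corresponding plans \<open>s\<close> and \<open>t\<close> stay within the budget and exhaust it, respectively. If
  \<open>l = 0\<close> there is no room on the left, but then the multiplier charges so little for
  unused budget that \<open>s\<close> alone is nearly optimal.\<close>

lemma dual_approx_attained:
  assumes l: "0 \<le> l" "\<And>l'. 0 \<le> l' \<Longrightarrow> \<phi> l \<le> \<phi> l'" and e: "0 < e"
  shows "\<exists>\<theta> s t. 0 \<le> \<theta> \<and> \<theta> \<le> 1 \<and> (\<forall>i\<in>I. s i \<in> S) \<and> (\<forall>i\<in>I. t i \<in> S)
    \<and> \<theta> * (\<Sum>i\<in>I. w i * c i (s i)) + (1 - \<theta>) * (\<Sum>i\<in>I. w i * c i (t i)) \<le> r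
    \<and> \<phi> l - e \<le> \<theta> * (\<Sum>i\<in>I. w i * g (s i)) + (1 - \<theta>) * (\<Sum>i\<in>I. w i * g (t i))"
proof -
  \<comment> \<open>Staying at distance \<open>\<delta>\<close> from \<open>l\<close> loses at most \<open>\<delta> * r\<close> if \<open>l = 0\<close> and \<open>2 * \<delta> * r\<close> otherwise;
    the bound \<open>\<delta> \<le> l\<close> keeps the multiplier \<open>l - \<delta>\<close> nonnegative.\<close>
  define \<delta> where "\<delta> = (if l = 0 then e / r else min l (e / (2 * r)))"
  have \<delta>: "0 < \<delta>" unfolding \<delta>_def using l(1) e r_pos by auto
  obtain s where s: "\<And>i. i \<in> I \<Longrightarrow> s i \<in> S"
    and s_eq: "\<phi> (l + \<delta>) = r * (l + \<delta>) + (\<Sum>i\<in>I. w i * g (s i)) - (l + \<delta>) * (\<Sum>i\<in>I. w i * c i (s i))"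
    and s_le: "\<And>l'. r * l' + (\<Sum>i\<in>I. w i * g (s i)) - l' * (\<Sum>i\<in>I. w i * c i (s i)) \<le> \<phi> l'"
    using dual_maximizers[of "l + \<delta>"] by blast
  define G where "G = (\<Sum>i\<in>I. w i * g (s i))"
  define D where "D = (\<Sum>i\<in>I. w i * c i (s i))"
  have D0: "0 \<le> D" unfolding D_def using s w_nonneg c_nonneg by (intro sum_nonneg) auto
  have up: "\<phi> l \<le> \<phi> (l + \<delta>)" using l \<delta> by simp
  have "0 \<le> \<delta> * (r - D)"
    using up s_eq s_le[of l] unfolding G_def[symmetric] D_def[symmetric]
    by (simp add: algebra_simps)
  then have Dr: "D \<le> r" using \<delta> by (simp add: zero_le_mult_iff)
  show ?thesis
  proof (cases "l = 0")
    case True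
    have "\<delta> * (r - D) \<le> \<delta> * r" using \<delta> D0 by simp
    also have "\<delta> * r = e" using True r_pos by (simp add: \<delta>_def)
    finally have "\<phi> l - e \<le> G"
      using up s_eq True unfolding G_def[symmetric] D_def[symmetric] by (simp add: algebra_simps)
    then show ?thesis
      using s Dr unfolding G_def D_def
      by (intro exI[of _ 1] exI[of _ s] conjI) auto
  next
    case False
    then have dl: "\<delta> \<le> l" "\<delta> * (2 * r) \<le> e"
      using r_pos by (auto simp: \<delta>_def min_def field_simps)
    obtain t where t: "\<And>i. i \<in> I \<Longrightarrow> t i \<in> S"
      and t_eq: "\<phi> (l - \<delta>) = r * (l - \<delta>) + (\<Sum>i\<in>I. w i * g (t i)) - (l - \<delta>) * (\<Sum>i\<in>I. w i * c i (t i))"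
      and t_le: "\<And>l'. r * l' + (\<Sum>i\<in>I. w i * g (t i)) - l' * (\<Sum>i\<in>I. w i * c i (t i)) \<le> \<phi> l'"
      using dual_maximizers[of "l - \<delta>"] by blast
    define G' where "G' = (\<Sum>i\<in>I. w i * g (t i))"
    define D' where "D' = (\<Sum>i\<in>I. w i * c i (t i))"
    have down: "\<phi> l \<le> \<phi> (l - \<delta>)" using l dl by simp
    have "0 \<le> \<delta> * (D' - r)"
      using down t_eq t_le[of l] unfolding G'_def[symmetric] D'_def[symmetric]
      by (simp add: algebra_simps)
    then have D'r: "r \<le> D'" using \<delta> by (simp add: zero_le_mult_iff)
    \<comment> \<open>The weight that makes the mixed plan cost exactly \<open>r\<close>; if \<open>D = D'\<close>, both costs equal \<open>r\<close>.\<close>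
    define \<theta> where "\<theta> = (if D = D' then 1 else (D' - r) / (D' - D))"
    have \<theta>: "0 \<le> \<theta>" "\<theta> \<le> 1" "\<theta> * D + (1 - \<theta>) * D' = r"
      unfolding \<theta>_def using Dr D'r by (auto simp: divide_simps) (auto simp: algebra_simps)
    have "G = \<phi> (l + \<delta>) - (l + \<delta>) * (r - D)" "G' = \<phi> (l - \<delta>) - (l - \<delta>) * (r - D')"
      using s_eq t_eq unfolding G_def D_def G'_def D'_def by (simp_all add: algebra_simps)
    then have "\<phi> l - (l + \<delta>) * (r - D) \<le> G" "\<phi> l - (l - \<delta>) * (r - D') \<le> G'"
      using up down by auto
    then have "\<theta> * (\<phi> l - (l + \<delta>) * (r - D)) + (1 - \<theta>) * (\<phi> l - (l - \<delta>) * (r - D'))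
        \<le> \<theta> * G + (1 - \<theta>) * G'"
      using \<theta> by (intro add_mono mult_left_mono) auto
    \<comment> \<open>The last term vanishes because the mixed plan costs exactly \<open>r\<close>; what remains is the gap
      \<open>2 * \<delta>\<close> between the two multipliers times \<open>\<theta>\<close> times the budget that the cheap plan \<open>s\<close> leaves unused.\<close>
    moreover have "\<theta> * (\<phi> l - (l + \<delta>) * (r - D)) + (1 - \<theta>) * (\<phi> l - (l - \<delta>) * (r - D'))
        = \<phi> l - 2 * \<delta> * (\<theta> * (r - D)) - (l - \<delta>) * (r - (\<theta> * D + (1 - \<theta>) * D'))"
      by (simp add: algebra_simps)
    moreover have "2 * \<delta> * (\<theta> * (r - D)) \<le> e"
    proof -
      have "\<theta> * (r - D) \<le> 1 * r" using \<theta> D0 Dr r_pos by (intro mult_mono) auto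
      then have "2 * \<delta> * (\<theta> * (r - D)) \<le> 2 * \<delta> * r" using \<delta> by simp
      then show ?thesis using dl by simp
    qed
    ultimately have "\<phi> l - e \<le> \<theta> * G + (1 - \<theta>) * G'"
      using \<theta>(3) by simp
    then show ?thesis
      using \<theta> s t unfolding G_def D_def G'_def D'_def
      by (intro exI[of _ \<theta>] exI[of _ s] exI[of _ t] conjI) auto
  qed
qed

end

section \<open>Continuity and measurability of the p-norm\<close>

lemma continuous_on_p_norm:
  fixes u :: "'b::topological_space \<Rightarrow> real ^ 'k"
  assumes "0 < p" "continuous_on T u"
  shows "continuous_on T (\<lambda>z. p_norm p (u z))"
  unfolding p_norm_def
  using assms by (intro continuous_intros continuous_on_powr') (auto intro!: sum_nonneg)

lemma p_norm_nonneg: "0 \<le> p_norm p v"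
  unfolding p_norm_def by simp

lemma p_norm_0 [simp]: "p_norm p 0 = 0"
  unfolding p_norm_def by simp

lemma continuous_on_of_p_norm_lipschitz:
  fixes S :: "(real ^ 'k) set" and g :: "real ^ 'k \<Rightarrow> real"
  assumes "0 < p" "\<And>s t. s \<in> S \<Longrightarrow> t \<in> S \<Longrightarrow> \<bar>g s - g t\<bar> \<le> c * p_norm p (s - t)"
  shows "continuous_on S g"
  unfolding continuous_on_def
proof
  fix t assume t: "t \<in> S"
  have "continuous_on S (\<lambda>s. c * p_norm p (s - t))"
    by (intro continuous_intros continuous_on_p_norm assms(1))
  then have "((\<lambda>s. c * p_norm p (s - t)) \<longlongrightarrow> c * p_norm p (t - t)) (at t within S)"
    using t unfolding continuous_on_def by blast
  then have lim: "((\<lambda>s. c * p_norm p (s - t)) \<longlongrightarrow> 0) (at t within S)" by simp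
  have "((\<lambda>s. g s - g t) \<longlongrightarrow> 0) (at t within S)"
    by (rule Lim_null_comparison[OF _ lim])
      (use assms(2) t in \<open>auto simp: eventually_at_filter\<close>)
  then show "(g \<longlongrightarrow> g t) (at t within S)" by (simp add: LIM_zero_iff)
qed

lemma space_borel_on [simp]: "space (borel_on S) = S"
  unfolding borel_on_def by (simp add: space_restrict_space)

lemma borel_measurable_borel_on:
  "continuous_on S g \<Longrightarrow> (g :: _ \<Rightarrow> real) \<in> borel_measurable (borel_on S)"
  unfolding borel_on_def by (rule borel_measurable_continuous_on_restrict)

lemma measurable_borel_on_borel [measurable]: "(\<lambda>x. x) \<in> borel_on S \<rightarrow>\<^sub>M borel"
  unfolding borel_on_def by (rule measurable_restrict_space1) simp

lemma borel_measurable_p_norm: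
  assumes "0 < p"
  shows "p_norm p \<in> borel_measurable borel"
  by (intro borel_measurable_continuous_onI continuous_on_p_norm assms continuous_on_id)

lemma borel_measurable_p_norm_diff:
  fixes S :: "(real ^ 'k) set"
  assumes "0 < p"
  shows "(\<lambda>z. p_norm p (fst z - snd z)) \<in> borel_measurable (borel_on S \<Otimes>\<^sub>M borel_on S)"
proof -
  note [measurable] = borel_measurable_p_norm[OF assms]
  have [measurable]: "fst \<in> borel_on S \<Otimes>\<^sub>M borel_on S \<rightarrow>\<^sub>M (borel :: (real^'k) measure)"
      "snd \<in> borel_on S \<Otimes>\<^sub>M borel_on S \<rightarrow>\<^sub>M (borel :: (real^'k) measure)"
    using measurable_compose[OF measurable_fst measurable_borel_on_borel]
      measurable_compose[OF measurable_snd measurable_borel_on_borel] by auto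
  show ?thesis by measurable
qed

section \<open>Finitely supported measures and transport between them\<close>

text \<open>The index set carries the weights and is pushed forward, so atoms may coincide; in particular
  the mass of one atom can be split over several indices.\<close>

definition discrete_measure ::
  "'a::topological_space set \<Rightarrow> 'i set \<Rightarrow> ('i \<Rightarrow> real) \<Rightarrow> ('i \<Rightarrow> 'a) \<Rightarrow> 'a measure" where
  "discrete_measure S J u a = distr (point_measure J (\<lambda>j. ennreal (u j))) (borel_on S) a"

lemma sets_discrete_measure [simp, measurable_cong]:
  "sets (discrete_measure S J u a) = sets (borel_on S)"
  unfolding discrete_measure_def by simp

lemma emeasure_discrete_measure:
  assumes "finite J" "a ` J \<subseteq> S" "A \<in> sets (borel_on S)" "\<And>j. j \<in> J \<Longrightarrow> 0 \<le> u j"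
  shows "emeasure (discrete_measure S J u a) A = ennreal (\<Sum>j\<in>J. u j * indicator A (a j))"
proof -
  have "emeasure (discrete_measure S J u a) A
      = emeasure (point_measure J (\<lambda>j. ennreal (u j))) {j\<in>J. a j \<in> A}"
    unfolding discrete_measure_def
    using assms(2,3)
    by (subst emeasure_distr) (auto simp: space_point_measure intro!: arg_cong2[where f=emeasure])
  also have "\<dots> = (\<Sum>j\<in>{j\<in>J. a j \<in> A}. ennreal (u j))"
    using assms(1) by (intro emeasure_point_measure_finite) auto
  also have "\<dots> = ennreal (\<Sum>j\<in>{j\<in>J. a j \<in> A}. u j)"
    by (intro sum_ennreal) (simp add: assms(4))
  also have "(\<Sum>j\<in>{j\<in>J. a j \<in> A}. u j) = (\<Sum>j\<in>J. u j * indicator A (a j))"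
    unfolding sum.inter_filter[OF assms(1)] by (intro sum.cong) auto
  finally show ?thesis .
qed

lemma integral_discrete_measure:
  fixes g :: "'a::topological_space \<Rightarrow> real"
  assumes "finite J" "a ` J \<subseteq> S" "\<And>j. j \<in> J \<Longrightarrow> 0 \<le> u j" "g \<in> borel_measurable (borel_on S)"
  shows "(\<integral>t. g t \<partial>discrete_measure S J u a) = (\<Sum>j\<in>J. u j * g (a j))"
proof -
  have "(\<integral>t. g t \<partial>discrete_measure S J u a) = (\<integral>j. g (a j) \<partial>point_measure J (\<lambda>j. ennreal (u j)))"
    unfolding discrete_measure_def using assms by (subst integral_distr) auto
  also have "\<dots> = (\<Sum>j\<in>J. u j * g (a j))"
    using assms(1,3) lebesgue_integral_point_measure_finite[of J u "\<lambda>j. g (a j)"] by simp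
  finally show ?thesis .
qed

lemma prob_space_point_measure_real:
  assumes "finite J" "\<And>j. j \<in> J \<Longrightarrow> 0 \<le> u j" "(\<Sum>j\<in>J. u j) = 1"
  shows "prob_space (point_measure J (\<lambda>j. ennreal (u j)))"
  using assms by (intro prob_space_point_measure) (auto simp: sum_ennreal)

text \<open>Two measures pushed forward from the same weighted index set are coupled by the joint map
  \<open>\<lambda>j. (s j, a j)\<close>, which is a transport plan of exactly this cost.\<close>

lemma wasserstein_discrete_le:
  fixes S :: "(real ^ 'k) set"
  assumes "0 < p" "finite J" "s ` J \<subseteq> S" "a ` J \<subseteq> S" "\<And>j. j \<in> J \<Longrightarrow> 0 \<le> u j" "(\<Sum>j\<in>J. u j) = 1"
  shows "wasserstein p S (discrete_measure S J u s) (discrete_measure S J u a)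
    \<le> ennreal (\<Sum>j\<in>J. u j * p_norm p (s j - a j))"
proof -
  define M where "M = point_measure J (\<lambda>j. ennreal (u j))"
  interpret prob_space M
    unfolding M_def using assms(2,5,6) by (rule prob_space_point_measure_real)
  define \<gamma> where "\<gamma> = distr M (borel_on S \<Otimes>\<^sub>M borel_on S) (\<lambda>j. (s j, a j))"
  have meas: "(\<lambda>j. (s j, a j)) \<in> M \<rightarrow>\<^sub>M borel_on S \<Otimes>\<^sub>M borel_on S"
    unfolding M_def using assms(3,4) by (auto simp: space_pair_measure)
  have "\<gamma> \<in> couplings S (discrete_measure S J u s) (discrete_measure S J u a)"
    unfolding couplings_def \<gamma>_def discrete_measure_def M_def[symmetric]
    using meas by (auto intro: prob_space_distr simp: distr_distr o_def)
  then have "wasserstein p S (discrete_measure S J u s) (discrete_measure S J u a)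
      \<le> (\<integral>\<^sup>+ z. ennreal (p_norm p (fst z - snd z)) \<partial>\<gamma>)"
    unfolding wasserstein_def by (rule INF_lower)
  also have "\<dots> = (\<integral>\<^sup>+ j. ennreal (p_norm p (s j - a j)) \<partial>M)"
    unfolding \<gamma>_def using meas measurable_compose[OF borel_measurable_p_norm_diff[OF assms(1)] measurable_ennreal]
    by (subst nn_integral_distr) auto
  also have "\<dots> = (\<Sum>j\<in>J. ennreal (u j * p_norm p (s j - a j)))"
    unfolding M_def using assms(2,5)
    by (subst nn_integral_point_measure_finite) (auto simp: ennreal_mult p_norm_nonneg intro!: sum.cong)
  also have "\<dots> = ennreal (\<Sum>j\<in>J. u j * p_norm p (s j - a j))"
    using assms(5) by (intro sum_ennreal) (simp add: p_norm_nonneg)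
  finally show ?thesis .
qed

section \<open>Duality for the worst-case expectation around a discrete measure\<close>

text \<open>Weak duality for one coupling. Its second marginal is concentrated on the atoms, so the
  feasibility inequality holds almost everywhere and may be integrated. Injectivity of the atoms makes
  \<open>\<nu>\<close> a function on the support.\<close>

lemma coupling_duality:
  fixes S :: "(real ^ 'k) set"
  assumes p: "0 < p" and S: "compact S" and g: "continuous_on S g"
    and J: "finite J" "a ` J \<subseteq> S" "inj_on a J" "\<And>j. j \<in> J \<Longrightarrow> 0 \<le> u j"
    and l: "0 \<le> l" and feas: "\<And>s j. s \<in> S \<Longrightarrow> j \<in> J \<Longrightarrow> g s \<le> \<nu> j + l * p_norm p (s - a j)"
    and \<gamma>: "\<gamma> \<in> couplings S P (discrete_measure S J u a)"
    and cost: "(\<integral>\<^sup>+ z. ennreal (p_norm p (fst z - snd z)) \<partial>\<gamma>) \<le> ennreal C" "0 \<le> C"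
  shows "(\<integral>s. g s \<partial>P) \<le> (\<Sum>j\<in>J. u j * \<nu> j) + l * C"
proof -
  define Q where "Q = discrete_measure S J u a"
  have sets\<gamma> [measurable_cong]: "sets \<gamma> = sets (borel_on S \<Otimes>\<^sub>M borel_on S)"
    and marg: "distr \<gamma> (borel_on S) fst = P" "distr \<gamma> (borel_on S) snd = Q"
    using \<gamma> unfolding couplings_def Q_def by auto
  interpret prob_space \<gamma> using \<gamma> unfolding couplings_def by auto
  have space\<gamma>: "space \<gamma> = S \<times> S"
    using sets_eq_imp_space_eq[OF sets\<gamma>] by (simp add: space_pair_measure)
  \<comment> \<open>The multipliers \<open>\<nu>\<close> as a measurable function of the point, zero off the atoms.\<close>
  define \<psi> where "\<psi> t = (\<Sum>j\<in>J. \<nu> j * indicator {a j} t)" for t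
  have \<psi>a: "\<psi> (a j) = \<nu> j" if "j \<in> J" for j
  proof -
    have "\<psi> (a j) = (\<Sum>i\<in>J. if i = j then \<nu> j else 0)"
      unfolding \<psi>_def using J(3) that by (intro sum.cong) (auto simp: indicator_def inj_on_def)
    then show ?thesis using J(1) that by simp
  qed
  note [measurable] = borel_measurable_borel_on[OF g] borel_measurable_p_norm_diff[OF p, of S]
  have [measurable]: "\<psi> \<in> borel_measurable (borel_on S)"
    unfolding borel_on_def \<psi>_def by (rule measurable_restrict_space1) measurable
  have [measurable]: "fst \<in> \<gamma> \<rightarrow>\<^sub>M borel_on S" "snd \<in> \<gamma> \<rightarrow>\<^sub>M borel_on S"
    by measurable
  define d where "d z = p_norm p (fst z - snd z)" for z :: "(real^'k) \<times> (real^'k)"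
  have d_meas [measurable]: "d \<in> borel_measurable \<gamma>"
    unfolding d_def by measurable
  have bdd: "\<exists>B. \<forall>z\<in>T. norm (q z) \<le> B" if "compact T" "continuous_on T q"
    for T :: "'z::topological_space set" and q :: "'z \<Rightarrow> real"
    using compact_imp_bounded[OF compact_continuous_image[OF that(2,1)]]
    unfolding bounded_iff by auto
  have int_g: "integrable \<gamma> (\<lambda>z. g (fst z))"
  proof -
    obtain B where "\<forall>z\<in>S. norm (g z) \<le> B" using bdd[OF S g] by auto
    then show ?thesis
      by (intro integrable_const_bound[where B=B] AE_I2) (auto simp: space\<gamma>)
  qed
  have int_\<psi>: "integrable \<gamma> (\<lambda>z. \<psi> (snd z))"
    by (intro integrable_const_bound[where B="\<Sum>j\<in>J. \<bar>\<nu> j\<bar>"] AE_I2)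
      (auto simp: \<psi>_def abs_mult indicator_def intro!: order.trans[OF sum_abs] sum_mono)
  have int_d: "integrable \<gamma> d"
  proof -
    have "continuous_on (S \<times> S) d"
      unfolding d_def by (intro continuous_on_p_norm p continuous_intros)
    then obtain B where "\<forall>z\<in>S\<times>S. norm (d z) \<le> B" using bdd[OF compact_Times[OF S S]] by blast
    then show ?thesis
      by (intro integrable_const_bound[where B=B] AE_I2) (auto simp: space\<gamma>)
  qed
  have "AE t in Q. t \<in> a ` J"
    unfolding Q_def discrete_measure_def
  proof (subst AE_distr_iff)
    have "a ` J = S \<inter> a ` J" using J(2) by auto
    then have "a ` J \<in> sets (borel_on S)"
      unfolding borel_on_def sets_restrict_space
      using J(1) by (intro image_eqI[where x="a ` J"] borel_closed finite_imp_closed) auto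
    then show "{t \<in> space (borel_on S). t \<in> a ` J} \<in> sets (borel_on S)"
      using J(2) by (simp add: Int_absorb1 Int_def[symmetric])
  qed (use J(2) in \<open>auto simp: AE_point_measure\<close>)
  then have atoms: "AE z in \<gamma>. snd z \<in> a ` J"
    unfolding marg(2)[symmetric] by (rule AE_distrD[rotated]) measurable
  have "(\<integral>s. g s \<partial>P) = (\<integral>z. g (fst z) \<partial>\<gamma>)"
    unfolding marg(1)[symmetric] by (subst integral_distr) auto
  also have "\<dots> \<le> (\<integral>z. \<psi> (snd z) + l * d z \<partial>\<gamma>)"
  proof (intro integral_mono_AE)
    show "integrable \<gamma> (\<lambda>z. g (fst z))" by (rule int_g)
    show "integrable \<gamma> (\<lambda>z. \<psi> (snd z) + l * d z)" using int_\<psi> int_d by simp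
    show "AE z in \<gamma>. g (fst z) \<le> \<psi> (snd z) + l * d z"
      using atoms AE_space
    proof eventually_elim
      case (elim z)
      then show ?case using feas \<psi>a unfolding d_def space\<gamma> by auto
    qed
  qed
  also have "\<dots> = (\<integral>z. \<psi> (snd z) \<partial>\<gamma>) + l * (\<integral>z. d z \<partial>\<gamma>)"
    using int_\<psi> int_d by simp
  also have "(\<integral>z. \<psi> (snd z) \<partial>\<gamma>) = (\<integral>t. \<psi> t \<partial>Q)"
    unfolding marg(2)[symmetric] by (subst integral_distr) auto
  also have "\<dots> = (\<Sum>j\<in>J. u j * \<psi> (a j))"
    unfolding Q_def using J by (intro integral_discrete_measure) auto
  also have "\<dots> = (\<Sum>j\<in>J. u j * \<nu> j)" using \<psi>a by simp
  also have "(\<integral>z. d z \<partial>\<gamma>) \<le> C"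
  proof -
    have "ennreal (\<integral>z. d z \<partial>\<gamma>) = (\<integral>\<^sup>+ z. ennreal (d z) \<partial>\<gamma>)"
      using int_d by (subst nn_integral_eq_integral) (auto simp: d_def p_norm_nonneg)
    also have "\<dots> \<le> ennreal C" using cost(1) unfolding d_def .
    finally show ?thesis using cost(2) by (simp only: ennreal_le_iff)
  qed
  finally show ?thesis using l by (simp add: mult_left_mono)
qed

text \<open>The Wasserstein distance is an infimum, so a distance of at most \<open>r\<close> yields couplings of cost
  below \<open>r + \<delta>\<close> for every \<open>\<delta> > 0\<close>; letting \<open>\<delta>\<close> tend to zero gives the bound with \<open>r\<close>.\<close>

lemma expectation_le_dual:
  fixes S :: "(real ^ 'k) set"
  assumes p: "0 < p" and S: "compact S" and g: "continuous_on S g"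
    and J: "finite J" "a ` J \<subseteq> S" "inj_on a J" "\<And>j. j \<in> J \<Longrightarrow> 0 \<le> u j"
    and l: "0 \<le> l" and feas: "\<And>s j. s \<in> S \<Longrightarrow> j \<in> J \<Longrightarrow> g s \<le> \<nu> j + l * p_norm p (s - a j)"
    and r: "0 \<le> r" and P: "P \<in> ambiguity p S r (discrete_measure S J u a)"
  shows "(\<integral>s. g s \<partial>P) \<le> (\<Sum>j\<in>J. u j * \<nu> j) + r * l"
proof (rule field_le_epsilon)
  fix e :: real assume e: "0 < e"
  define \<delta> where "\<delta> = e / (l + 1)"
  have \<delta>: "0 < \<delta>" "l * \<delta> \<le> e" unfolding \<delta>_def using e l by (auto simp: field_simps)
  have "wasserstein p S P (discrete_measure S J u a) \<le> ennreal r"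
    using P unfolding ambiguity_def by simp
  also have "\<dots> < ennreal (r + \<delta>)" using \<delta> r by (simp add: ennreal_less_iff)
  finally obtain \<gamma> where \<gamma>: "\<gamma> \<in> couplings S P (discrete_measure S J u a)"
      "(\<integral>\<^sup>+ z. ennreal (p_norm p (fst z - snd z)) \<partial>\<gamma>) < ennreal (r + \<delta>)"
    unfolding wasserstein_def INF_less_iff by blast
  have "(\<integral>s. g s \<partial>P) \<le> (\<Sum>j\<in>J. u j * \<nu> j) + l * (r + \<delta>)"
    using \<delta> r \<gamma>(2) by (intro coupling_duality[OF p S g J l feas \<gamma>(1)]) auto
  then show "(\<integral>s. g s \<partial>P) \<le> (\<Sum>j\<in>J. u j * \<nu> j) + r * l + e"
    using \<delta> by (simp add: algebra_simps)
qed

lemma discrete_measure_in_ambiguity: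
  fixes S :: "(real ^ 'k) set"
  assumes "0 < p" "finite J" "s ` J \<subseteq> S" "a ` J \<subseteq> S" "\<And>j. j \<in> J \<Longrightarrow> 0 \<le> u j" "(\<Sum>j\<in>J. u j) = 1"
    and "(\<Sum>j\<in>J. u j * p_norm p (s j - a j)) \<le> r"
  shows "discrete_measure S J u s \<in> ambiguity p S r (discrete_measure S J u a)"
proof -
  interpret M: prob_space "point_measure J (\<lambda>j. ennreal (u j))"
    using assms(2,5,6) by (rule prob_space_point_measure_real)
  have "prob_space (discrete_measure S J u s)"
    unfolding discrete_measure_def using assms(3) by (intro M.prob_space_distr) auto
  moreover have "wasserstein p S (discrete_measure S J u s) (discrete_measure S J u a) \<le> ennreal r"
    using wasserstein_discrete_le[OF assms(1-6)] assms(7) by (meson ennreal_leI order_trans)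
  ultimately show ?thesis unfolding ambiguity_def borel_probs_def by simp
qed

text \<open>The dual side is the abstract duality with \<open>c j s = p_norm p (s - a j)\<close>. On the primal side, the
  mixture of the plans \<open>s\<close> and \<open>t\<close> becomes a single discrete measure on the doubled index set
  \<open>J \<times> UNIV\<close>: the index \<open>(j, True)\<close> carries the fraction \<open>\<theta>\<close> of the mass of atom \<open>j\<close> to \<open>s j\<close>,
  and \<open>(j, False)\<close> carries the rest to \<open>t j\<close>.\<close>

theorem worst_case_strong_duality:
  fixes S :: "(real ^ 'k) set" and a :: "'i \<Rightarrow> real ^ 'k"
  assumes p: "0 < p" and S: "compact S" and g: "continuous_on S g"
    and J: "finite J" "a ` J \<subseteq> S" "inj_on a J" "\<And>j. j \<in> J \<Longrightarrow> 0 \<le> u j" "(\<Sum>j\<in>J. u j) = 1"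
    and r: "0 < r"
  shows "\<exists>\<nu> l. 0 \<le> l \<and> (\<forall>s\<in>S. \<forall>j\<in>J. g s \<le> \<nu> j + l * p_norm p (s - a j))
    \<and> (SUP P\<in>ambiguity p S r (discrete_measure S J u a). ereal (\<integral>s. g s \<partial>P))
      = ereal ((\<Sum>j\<in>J. u j * \<nu> j) + r * l)"
proof -
  define c where "c j s = p_norm p (s - a j)" for j s
  have "J \<noteq> {}" using J(5) by auto
  then have S_ne: "S \<noteq> {}" using J(2) by auto
  have cont_cost: "continuous_on S (c j)" for j
    unfolding c_def by (intro continuous_on_p_norm p continuous_intros)
  interpret transport_dual S g c J u r
  proof
    show "\<exists>s\<in>S. c j s = 0" if "j \<in> J" for j
      using J(2) that by (intro bexI[of _ "a j"]) (auto simp: c_def)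
  qed (use S S_ne g cont_cost J(4) r in \<open>auto simp: c_def p_norm_nonneg\<close>)
  obtain l where l: "0 \<le> l" "\<And>l'. 0 \<le> l' \<Longrightarrow> \<phi> l \<le> \<phi> l'"
    using dual_minimizer by blast
  define \<nu> where "\<nu> j = penalized_sup S g (c j) l" for j
  have feas: "g s \<le> \<nu> j + l * p_norm p (s - a j)" if "s \<in> S" "j \<in> J" for s j
    using penalized_sup_upper[OF S g cont_cost[of j] that(1), of l] unfolding \<nu>_def c_def by simp
  have val: "(\<Sum>j\<in>J. u j * \<nu> j) + r * l = \<phi> l"
    unfolding dual_fun_def \<nu>_def by simp
  let ?A = "ambiguity p S r (discrete_measure S J u a)"
  have "(SUP P\<in>?A. ereal (\<integral>s. g s \<partial>P)) \<le> ereal (\<phi> l)"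
    using expectation_le_dual[where u=u, OF p S g J(1-4) l(1) feas] r
    unfolding val[symmetric] by (intro SUP_least) simp
  moreover have "ereal (\<phi> l) \<le> (SUP P\<in>?A. ereal (\<integral>s. g s \<partial>P))"
  proof (rule ereal_le_epsilon2)
    fix e :: real assume "0 < e"
    then obtain \<theta> s t where \<theta>: "0 \<le> \<theta>" "\<theta> \<le> 1"
      and st: "\<And>i. i \<in> J \<Longrightarrow> s i \<in> S" "\<And>i. i \<in> J \<Longrightarrow> t i \<in> S"
      and cost: "\<theta> * (\<Sum>i\<in>J. u i * c i (s i)) + (1 - \<theta>) * (\<Sum>i\<in>J. u i * c i (t i)) \<le> r"
      and gain: "\<phi> l - e \<le> \<theta> * (\<Sum>i\<in>J. u i * g (s i)) + (1 - \<theta>) * (\<Sum>i\<in>J. u i * g (t i))"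
      using dual_approx_attained[OF l] by blast
    define K where "K = J \<times> (UNIV :: bool set)"
    define v where "v k = (if snd k then \<theta> else 1 - \<theta>) * u (fst k)" for k :: "'i \<times> bool"
    define y where "y k = (if snd k then s (fst k) else t (fst k))" for k :: "'i \<times> bool"
    have K_sum: "(\<Sum>k\<in>K. q k) = (\<Sum>i\<in>J. q (i, True)) + (\<Sum>i\<in>J. q (i, False))"
      for q :: "'i \<times> bool \<Rightarrow> real"
      unfolding K_def using sum.cartesian_product[of "\<lambda>i b. q (i, b)" UNIV J]
      by (simp add: UNIV_bool sum.distrib add.commute)
    have K: "finite K" "y ` K \<subseteq> S" "(a \<circ> fst) ` K \<subseteq> S" "\<And>k. k \<in> K \<Longrightarrow> 0 \<le> v k"
      using J st \<theta> unfolding K_def y_def v_def by auto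
    have v_sum: "(\<Sum>k\<in>K. v k * q (fst k)) = (\<Sum>j\<in>J. u j * q j)" for q :: "'i \<Rightarrow> real"
      unfolding K_sum v_def sum.distrib[symmetric] by (intro sum.cong) (auto simp: algebra_simps)
    \<comment> \<open>Splitting the mass of the atoms does not change the centre of the ball.\<close>
    have "discrete_measure S K v (a \<circ> fst) = discrete_measure S J u a"
    proof (rule measure_eqI)
      fix A assume "A \<in> sets (discrete_measure S K v (a \<circ> fst))"
      then show "emeasure (discrete_measure S K v (a \<circ> fst)) A = emeasure (discrete_measure S J u a) A"
        using K J v_sum[of "\<lambda>j. indicator A (a j)"] by (simp add: emeasure_discrete_measure)
    qed simp
    moreover have "discrete_measure S K v y \<in> ambiguity p S r (discrete_measure S K v (a \<circ> fst))"
    proof (rule discrete_measure_in_ambiguity[OF p K])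
      show "(\<Sum>k\<in>K. v k) = 1" using v_sum[of "\<lambda>_. 1"] J(5) by simp
      show "(\<Sum>k\<in>K. v k * p_norm p (y k - (a \<circ> fst) k)) \<le> r"
        using cost unfolding K_sum by (simp add: v_def y_def c_def sum_distrib_left mult.assoc)
    qed
    ultimately have "discrete_measure S K v y \<in> ?A" by simp
    moreover have "\<phi> l - e \<le> (\<integral>s. g s \<partial>discrete_measure S K v y)"
    proof -
      have "(\<integral>s. g s \<partial>discrete_measure S K v y) = (\<Sum>k\<in>K. v k * g (y k))"
        using K(1,2,4) borel_measurable_borel_on[OF g] by (rule integral_discrete_measure)
      then show ?thesis
        using gain unfolding K_sum by (simp add: v_def y_def sum_distrib_left mult.assoc)
    qed
    ultimately have "ereal (\<phi> l - e) \<le> (SUP P\<in>?A. ereal (\<integral>s. g s \<partial>P))"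
      by (intro SUP_upper2) auto
    then have "ereal (\<phi> l - e) + ereal e \<le> (SUP P\<in>?A. ereal (\<integral>s. g s \<partial>P)) + ereal e"
      by (rule add_right_mono)
    then show "ereal (\<phi> l) \<le> (SUP P\<in>?A. ereal (\<integral>s. g s \<partial>P)) + ereal e"
      by simp
  qed
  ultimately have "(SUP P\<in>?A. ereal (\<integral>s. g s \<partial>P)) = ereal ((\<Sum>j\<in>J. u j * \<nu> j) + r * l)"
    unfolding val by (rule antisym)
  then show ?thesis using l(1) feas
    by (intro exI[of _ \<nu>] exI[of _ l] conjI ballI)
qed

section \<open>The interpolation as a discrete measure\<close>

lemma sets_mixture [simp]: "sets (mixture S I w m) = sets (borel_on S)"
proof -
  interpret sigma_algebra S "sets (borel_on S)"
    using sets.sigma_algebra_axioms[of "borel_on S"] by simp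
  show ?thesis unfolding mixture_def by simp
qed

lemma emeasure_mixture:
  fixes m :: "'i \<Rightarrow> 'a::topological_space measure"
  assumes "\<And>i. i \<in> I \<Longrightarrow> sets (m i) = sets (borel_on S)" "A \<in> sets (borel_on S)"
  shows "emeasure (mixture S I w m) A = (\<Sum>i\<in>I. ennreal (w i) * emeasure (m i) A)"
  unfolding mixture_def
proof (rule emeasure_measure_of_sigma)
  show "sigma_algebra S (sets (borel_on S))"
    using sets.sigma_algebra_axioms[of "borel_on S"] by simp
  show "positive (sets (borel_on S)) (\<lambda>A. \<Sum>i\<in>I. ennreal (w i) * emeasure (m i) A)"
    by (simp add: positive_def)
  show "countably_additive (sets (borel_on S)) (\<lambda>A. \<Sum>i\<in>I. ennreal (w i) * emeasure (m i) A)"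
  proof (rule countably_additiveI)
    fix B :: "nat \<Rightarrow> 'a set"
    assume B: "range B \<subseteq> sets (borel_on S)" "disjoint_family B"
    have "(\<Sum>n. \<Sum>i\<in>I. ennreal (w i) * emeasure (m i) (B n))
        = (\<Sum>i\<in>I. \<Sum>n. ennreal (w i) * emeasure (m i) (B n))"
      by (rule suminf_sum) simp
    also have "\<dots> = (\<Sum>i\<in>I. ennreal (w i) * emeasure (m i) (\<Union> (range B)))"
      using B assms(1) by (intro sum.cong) (auto simp: suminf_emeasure)
    finally show "(\<Sum>n. \<Sum>i\<in>I. ennreal (w i) * emeasure (m i) (B n))
        = (\<Sum>i\<in>I. ennreal (w i) * emeasure (m i) (\<Union> (range B)))" .
  qed
qed (rule assms(2))

lemma emeasure_mixture_discrete_measure: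
  assumes "finite I" "\<And>i. i \<in> I \<Longrightarrow> finite (J i)" "\<And>i. i \<in> I \<Longrightarrow> a ` J i \<subseteq> S"
    and "\<And>i. i \<in> I \<Longrightarrow> 0 \<le> w i" "\<And>i j. i \<in> I \<Longrightarrow> j \<in> J i \<Longrightarrow> 0 \<le> u i j"
    and "A \<in> sets (borel_on S)"
  shows "emeasure (mixture S I w (\<lambda>i. discrete_measure S (J i) (u i) a)) A
    = ennreal (\<Sum>i\<in>I. w i * (\<Sum>j\<in>J i. u i j * indicator A (a j)))"
proof -
  have nn: "0 \<le> (\<Sum>j\<in>J i. u i j * indicator A (a j))" if "i \<in> I" for i
    using assms(5)[OF that] by (intro sum_nonneg) (auto simp: indicator_def)
  have "emeasure (mixture S I w (\<lambda>i. discrete_measure S (J i) (u i) a)) A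
      = (\<Sum>i\<in>I. ennreal (w i) * ennreal (\<Sum>j\<in>J i. u i j * indicator A (a j)))"
    using assms(2,3,5,6)
    by (subst emeasure_mixture)
      (auto simp only: sets_discrete_measure emeasure_discrete_measure intro!: sum.cong)
  also have "\<dots> = (\<Sum>i\<in>I. ennreal (w i * (\<Sum>j\<in>J i. u i j * indicator A (a j))))"
    by (intro sum.cong refl ennreal_mult[symmetric] assms(4) nn)
  also have "\<dots> = ennreal (\<Sum>i\<in>I. w i * (\<Sum>j\<in>J i. u i j * indicator A (a j)))"
    by (intro sum_ennreal mult_nonneg_nonneg assms(4) nn)
  finally show ?thesis .
qed

lemma empirical_eq_discrete:
  assumes "\<And>n. n \<in> {1..N} \<Longrightarrow> \<xi> n \<in> S"
  shows "empirical S N xs \<xi> y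
    = discrete_measure S (obs_at N xs y) (\<lambda>_. 1 / real (card (obs_at N xs y))) \<xi>"
proof (rule measure_eqI)
  fix A assume "A \<in> sets (empirical S N xs \<xi> y)"
  then have A: "A \<in> sets (borel_on S)" by (simp add: empirical_def)
  have fin: "finite (obs_at N xs y)" "\<xi> ` obs_at N xs y \<subseteq> S"
    using assms by (auto simp: obs_at_def)
  let ?u = "1 / real (card (obs_at N xs y))"
  have "emeasure (empirical S N xs \<xi> y) A
      = (\<Sum>n\<in>obs_at N xs y. ennreal ?u * emeasure (return (borel_on S) (\<xi> n)) A)"
    unfolding empirical_def by (rule emeasure_mixture) (simp_all add: A)
  also have "\<dots> = (\<Sum>n\<in>obs_at N xs y. ennreal (?u * indicator A (\<xi> n)))"
    using A by (intro sum.cong refl) (simp add: indicator_def)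
  also have "\<dots> = ennreal (\<Sum>n\<in>obs_at N xs y. ?u * indicator A (\<xi> n))"
    by (intro sum_ennreal) simp
  also have "\<dots> = emeasure (discrete_measure S (obs_at N xs y) (\<lambda>_. ?u) \<xi>) A"
    by (rule emeasure_discrete_measure[symmetric, OF fin A]) simp
  finally show "emeasure (empirical S N xs \<xi> y) A
      = emeasure (discrete_measure S (obs_at N xs y) (\<lambda>_. ?u) \<xi>) A" .
qed (simp add: empirical_def)

lemma sum_distinct_values:
  assumes "distinct_values N z K e" "n \<in> {1..N}"
  shows "(\<Sum>i=1..K. of_bool (z n = z (e i)) * q (z (e i))) = (q (z n) :: real)"
proof -
  have bij: "bij_betw (\<lambda>i. z (e i)) {1..K} (z ` {1..N})"
    using assms(1) unfolding distinct_values_def by simp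
  have "(\<Sum>i=1..K. of_bool (z n = z (e i)) * q (z (e i))) = (\<Sum>y\<in>z ` {1..N}. of_bool (z n = y) * q y)"
    by (rule sum.reindex_bij_betw[OF bij])
  also have "\<dots> = (\<Sum>y\<in>z ` {1..N}. if y = z n then q (z n) else 0)"
    by (intro sum.cong) auto
  also have "\<dots> = q (z n)" using assms(2) by (subst sum.delta) auto
  finally show ?thesis .
qed

text \<open>Integrating \<open>q\<close> against the interpolation, grouped by distinct \<open>\<xi>\<close>-values on the left and by distinct
  \<open>xs\<close>-values on the right. Both groupings are resolved to a sum over the data points \<open>n\<close>; each \<open>\<xi> n\<close>
  is listed by exactly one \<open>i\<close>. Indicator functions \<open>q\<close> identify the measures, and the constant
  \<open>q = 1\<close> gives the total mass.\<close>

lemma sum_interp_coeff: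
  assumes "distinct_values N \<xi> N\<xi> m\<xi>"
  shows "(\<Sum>i=1..N\<xi>. interp_coeff N xs \<xi> Nx nx m\<xi> \<omega> i x * q (\<xi> (m\<xi> i)))
    = (\<Sum>j=1..Nx. \<omega> j x * (\<Sum>n\<in>obs_at N xs (xs (nx j)).
        1 / real (card (obs_at N xs (xs (nx j)))) * (q (\<xi> n) :: real)))"
proof -
  let ?c = "\<lambda>j. \<omega> j x / real (card (obs_at N xs (xs (nx j))))"
  let ?G = "\<lambda>n. \<Sum>j=1..Nx. ?c j * of_bool (xs n = xs (nx j))"
  have "(\<Sum>i=1..N\<xi>. interp_coeff N xs \<xi> Nx nx m\<xi> \<omega> i x * q (\<xi> (m\<xi> i)))
      = (\<Sum>i=1..N\<xi>. \<Sum>n=1..N. ?G n * (of_bool (\<xi> n = \<xi> (m\<xi> i)) * q (\<xi> (m\<xi> i))))"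
    unfolding interp_coeff_def sum_distrib_right[of _ "{1..N}"] by (intro sum.cong) auto
  also have "\<dots> = (\<Sum>n=1..N. \<Sum>i=1..N\<xi>. ?G n * (of_bool (\<xi> n = \<xi> (m\<xi> i)) * q (\<xi> (m\<xi> i))))"
    by (rule sum.swap)
  also have "\<dots> = (\<Sum>n=1..N. ?G n * q (\<xi> n))"
    unfolding sum_distrib_left[symmetric] using sum_distinct_values[OF assms] by (intro sum.cong) auto
  also have "\<dots> = (\<Sum>j=1..Nx. \<Sum>n=1..N. ?c j * of_bool (xs n = xs (nx j)) * q (\<xi> n))"
    unfolding sum_distrib_right by (rule sum.swap)
  also have "\<dots> = (\<Sum>j=1..Nx. \<omega> j x * (\<Sum>n\<in>obs_at N xs (xs (nx j)).
        1 / real (card (obs_at N xs (xs (nx j)))) * q (\<xi> n)))"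
    unfolding obs_at_def sum_distrib_left sum.inter_filter[OF finite_atLeastAtMost]
    by (intro sum.cong) auto
  finally show ?thesis .
qed

lemma interp_eq_discrete:
  assumes dx: "distinct_values N xs Nx nx" and d\<xi>: "distinct_values N \<xi> N\<xi> m\<xi>"
    and \<xi>: "\<And>n. n \<in> {1..N} \<Longrightarrow> \<xi> n \<in> S"
    and \<omega>: "\<And>j. j \<in> {1..Nx} \<Longrightarrow> 0 \<le> \<omega> j x" "(\<Sum>j=1..Nx. \<omega> j x) = 1"
  defines "f \<equiv> \<lambda>i. interp_coeff N xs \<xi> Nx nx m\<xi> \<omega> i x"
  shows "interp S N xs \<xi> Nx nx \<omega> x = discrete_measure S {1..N\<xi>} f (\<lambda>i. \<xi> (m\<xi> i))"
    and "(\<Sum>i=1..N\<xi>. f i) = 1" and "\<And>i. 0 \<le> f i"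
    and "(\<lambda>i. \<xi> (m\<xi> i)) ` {1..N\<xi>} \<subseteq> S" "inj_on (\<lambda>i. \<xi> (m\<xi> i)) {1..N\<xi>}"
proof -
  show f0: "0 \<le> f i" for i
    unfolding f_def interp_coeff_def using \<omega>(1) by (intro sum_nonneg mult_nonneg_nonneg) auto
  show a: "(\<lambda>i. \<xi> (m\<xi> i)) ` {1..N\<xi>} \<subseteq> S" "inj_on (\<lambda>i. \<xi> (m\<xi> i)) {1..N\<xi>}"
    using d\<xi> \<xi> unfolding distinct_values_def bij_betw_def by auto
  have card_pos: "0 < card (obs_at N xs (xs (nx j)))" if "j \<in> {1..Nx}" for j
  proof -
    have "nx j \<in> obs_at N xs (xs (nx j))"
      using dx that unfolding distinct_values_def obs_at_def by blast
    then show ?thesis by (subst card_gt_0_iff) (auto simp: obs_at_def)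
  qed
  show "(\<Sum>i=1..N\<xi>. f i) = 1"
  proof -
    have "(\<Sum>i=1..N\<xi>. f i) = (\<Sum>j=1..Nx. \<omega> j x * (\<Sum>n\<in>obs_at N xs (xs (nx j)).
        1 / real (card (obs_at N xs (xs (nx j))))))"
      using sum_interp_coeff[OF d\<xi>, of xs Nx nx \<omega> x "\<lambda>_. 1"] unfolding f_def by simp
    also have "\<dots> = (\<Sum>j=1..Nx. \<omega> j x)"
    proof (intro sum.cong refl)
      show "\<omega> j x * (\<Sum>n\<in>obs_at N xs (xs (nx j)). 1 / real (card (obs_at N xs (xs (nx j))))) = \<omega> j x"
        if "j \<in> {1..Nx}" for j
        using card_pos[OF that] by simp
    qed
    finally show ?thesis using \<omega>(2) by simp
  qed
  show "interp S N xs \<xi> Nx nx \<omega> x = discrete_measure S {1..N\<xi>} f (\<lambda>i. \<xi> (m\<xi> i))"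
  proof (rule measure_eqI)
    fix A assume "A \<in> sets (interp S N xs \<xi> Nx nx \<omega> x)"
    then have A: "A \<in> sets (borel_on S)" by (simp add: interp_def)
    have empirical: "empirical S N xs \<xi> y
        = discrete_measure S (obs_at N xs y) (\<lambda>_. 1 / real (card (obs_at N xs y))) \<xi>" for y
      by (rule empirical_eq_discrete) (rule \<xi>)
    have "emeasure (interp S N xs \<xi> Nx nx \<omega> x) A
        = ennreal (\<Sum>j=1..Nx. \<omega> j x * (\<Sum>n\<in>obs_at N xs (xs (nx j)).
            1 / real (card (obs_at N xs (xs (nx j)))) * indicator A (\<xi> n)))"
      unfolding interp_def empirical
      using \<xi> \<omega>(1) A by (intro emeasure_mixture_discrete_measure) (auto simp: obs_at_def)
    also have "\<dots> = emeasure (discrete_measure S {1..N\<xi>} f (\<lambda>i. \<xi> (m\<xi> i))) A"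
      using sum_interp_coeff[OF d\<xi>, of xs Nx nx \<omega> x "indicator A"] a f0 A
      unfolding f_def by (simp add: emeasure_discrete_measure)
    finally show "emeasure (interp S N xs \<xi> Nx nx \<omega> x) A
        = emeasure (discrete_measure S {1..N\<xi>} f (\<lambda>i. \<xi> (m\<xi> i))) A" .
  qed (simp add: interp_def)
qed

section \<open>From inner values to the outer problems\<close>

text \<open>If \<open>v x\<close> is the minimum of \<open>J\<close> over the fibre of \<open>F\<close> at \<open>x\<close>, minimizing \<open>J\<close> jointly is minimizing
  \<open>v\<close>. It is the attainment in each fibre that lets an optimal \<open>x\<close> be completed to an optimal pair.\<close>

lemma partial_minimization_equivalence:
  assumes attained: "\<And>x. x \<in> X \<Longrightarrow> \<exists>\<nu>. (x, \<nu>) \<in> F \<and> J (x, \<nu>) = v x"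
    and bound: "\<And>x \<nu>. (x, \<nu>) \<in> F \<Longrightarrow> x \<in> X \<and> v x \<le> J (x, \<nu>)"
  shows "opt_value X v = opt_value F J"
    and "\<And>x. x \<in> X \<Longrightarrow> optimal_solution X v x \<longleftrightarrow> (\<exists>\<nu>. optimal_solution F J (x, \<nu>))"
proof -
  have "opt_value F J \<le> v x" if "x \<in> X" for x
    using attained[OF that] unfolding opt_value_def by (metis INF_lower)
  then have "opt_value F J \<le> opt_value X v"
    unfolding opt_value_def[of X] by (rule INF_greatest)
  moreover have "opt_value X v \<le> J z" if "z \<in> F" for z
    using bound[of "fst z" "snd z"] that unfolding opt_value_def by (auto intro: INF_lower2)
  then have "opt_value X v \<le> opt_value F J"
    unfolding opt_value_def[of F] by (rule INF_greatest)
  ultimately show eq: "opt_value X v = opt_value F J" by (rule antisym[rotated])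
  show "optimal_solution X v x \<longleftrightarrow> (\<exists>\<nu>. optimal_solution F J (x, \<nu>))" if "x \<in> X" for x
  proof
    assume "optimal_solution X v x"
    then show "\<exists>\<nu>. optimal_solution F J (x, \<nu>)"
      using attained[OF that] eq unfolding optimal_solution_def by metis
  next
    assume "\<exists>\<nu>. optimal_solution F J (x, \<nu>)"
    then obtain \<nu> where "(x, \<nu>) \<in> F" "J (x, \<nu>) = opt_value X v"
      using eq unfolding optimal_solution_def by auto
    then have "v x \<le> opt_value X v" using bound by metis
    moreover have "opt_value X v \<le> v x" unfolding opt_value_def using that by (rule INF_lower)
    ultimately show "optimal_solution X v x" using that unfolding optimal_solution_def by simp
  qed
qed

text \<open>Fibrewise duality: boundedness of \<open>h\<close> makes it real-valued and the Lipschitz condition makes it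
  continuous in \<open>s\<close>, so strong duality at \<open>x\<close> provides a feasible \<open>\<nu>\<close> with the worst-case value, and weak
  duality shows that no feasible \<open>\<nu>\<close> does better.\<close>

theorem theorem3:
  fixes X :: "(real ^ 'd) set" and dX :: "real ^ 'd \<Rightarrow> real ^ 'd \<Rightarrow> real"
    and \<Xi> :: "(real ^ 'k) set" and h :: "real ^ 'd \<Rightarrow> real ^ 'k \<Rightarrow> ereal"
    and p r :: real and N Nx N\<xi> :: nat
    and xs :: "nat \<Rightarrow> real ^ 'd" and \<xi> :: "nat \<Rightarrow> real ^ 'k"
    and nx m\<xi> :: "nat \<Rightarrow> nat" and \<omega> :: "nat \<Rightarrow> real ^ 'd \<Rightarrow> real"
  assumes "p \<ge> 1"
    and "X \<noteq> {}" and "Metric_space X dX"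
    and "compact X" and "bounded X" and "compact \<Xi>" and "bounded \<Xi>"
    and "\<exists>B::real. \<forall>x\<in>X. \<forall>s\<in>\<Xi>. \<bar>h x s\<bar> \<le> ereal B"
    and "\<forall>x\<in>X. \<exists>c>0. \<forall>s1\<in>\<Xi>. \<forall>s2\<in>\<Xi>. \<bar>h x s1 - h x s2\<bar> \<le> ereal (c * p_norm p (s1 - s2))"
    and "\<forall>n\<in>{1..N}. xs n \<in> X \<and> \<xi> n \<in> \<Xi>"
    and "distinct_values N xs Nx nx" and "distinct_values N \<xi> N\<xi> m\<xi>"
    and "is_interpolation X dX p \<Xi> N xs \<xi> Nx nx \<omega>"
    and "r > 0"
  defines "\<P> \<equiv> \<lambda>x. ambiguity p \<Xi> r (interp \<Xi> N xs \<xi> Nx nx \<omega> x)"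
    and "f \<equiv> interp_coeff N xs \<xi> Nx nx m\<xi> \<omega>"
    and "F \<equiv> sip_feasible p X \<Xi> h \<xi> N\<xi> m\<xi>"
  shows "opt_value X (worst_case h \<P>) = opt_value F (sip_objective f r N\<xi>)
    \<and> (\<forall>x\<in>X. optimal_solution X (worst_case h \<P>) x \<longleftrightarrow>
          (\<exists>\<nu>. optimal_solution F (sip_objective f r N\<xi>) (x, \<nu>)))"
proof -
  define g where "g x s = real_of_ereal (h x s)" for x s
  have h_eq: "h x s = ereal (g x s)" if "x \<in> X" "s \<in> \<Xi>" for x s
    using assms(8) that unfolding g_def by (cases "h x s") fastforce+
  have p: "0 < p" using assms(1) by simp
  have cont: "continuous_on \<Xi> (g x)" if x: "x \<in> X" for x
  proof -
    obtain c where "\<forall>s\<in>\<Xi>. \<forall>t\<in>\<Xi>. \<bar>h x s - h x t\<bar> \<le> ereal (c * p_norm p (s - t))"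
      using assms(9) x by blast
    then show ?thesis
      using h_eq[OF x] by (intro continuous_on_of_p_norm_lipschitz[OF p, of _ _ c]) auto
  qed
  define a where "a i = \<xi> (m\<xi> i)" for i
  define Q where "Q x = discrete_measure \<Xi> {1..N\<xi>} (\<lambda>i. f i x) a" for x
  have f: "interp \<Xi> N xs \<xi> Nx nx \<omega> x = Q x" "(\<Sum>i=1..N\<xi>. f i x) = 1" "\<And>i. 0 \<le> f i x"
    "a ` {1..N\<xi>} \<subseteq> \<Xi>" "inj_on a {1..N\<xi>}" if x: "x \<in> X" for x
  proof -
    have \<omega>: "\<And>j. j \<in> {1..Nx} \<Longrightarrow> 0 \<le> \<omega> j x" "(\<Sum>j=1..Nx. \<omega> j x) = 1"
      using assms(13) x unfolding is_interpolation_def by auto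
    have \<xi>: "\<And>n. n \<in> {1..N} \<Longrightarrow> \<xi> n \<in> \<Xi>" using assms(10) by blast
    note interp_eq = interp_eq_discrete[where \<omega>=\<omega> and x=x, OF assms(11,12) \<xi> \<omega>]
    show "interp \<Xi> N xs \<xi> Nx nx \<omega> x = Q x"
      unfolding Q_def f_def a_def by (rule interp_eq(1))
    show "(\<Sum>i=1..N\<xi>. f i x) = 1" unfolding f_def by (rule interp_eq(2))
    show "0 \<le> f i x" for i unfolding f_def by (rule interp_eq(3))
    show "a ` {1..N\<xi>} \<subseteq> \<Xi>" unfolding a_def by (rule interp_eq(4))
    show "inj_on a {1..N\<xi>}" unfolding a_def by (rule interp_eq(5))
  qed
  \<comment> \<open>On the feasible set all values of \<open>h\<close> are real, so the constraints are real inequalities.\<close>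
  have feas_iff: "(x, \<nu>) \<in> F \<longleftrightarrow> x \<in> X \<and> \<nu> \<in> {1..N\<xi> + 1} \<rightarrow>\<^sub>E UNIV \<and> 0 \<le> \<nu> (N\<xi> + 1)
      \<and> (\<forall>s\<in>\<Xi>. \<forall>i\<in>{1..N\<xi>}. g x s \<le> \<nu> i + \<nu> (N\<xi> + 1) * p_norm p (s - a i))" for x \<nu>
  proof -
    have "h x s - ereal (\<nu> i) - ereal (\<nu> (N\<xi> + 1) * p_norm p (s - a i)) \<le> 0
        \<longleftrightarrow> g x s \<le> \<nu> i + \<nu> (N\<xi> + 1) * p_norm p (s - a i)" if "x \<in> X" "s \<in> \<Xi>" for s i
      unfolding h_eq[OF that] ereal_minus(1) zero_ereal_def ereal_less_eq(3) by linarith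
    then show ?thesis
      unfolding F_def sip_feasible_def a_def by blast
  qed
  have worst: "worst_case h \<P> x = (SUP P\<in>ambiguity p \<Xi> r (Q x). ereal (\<integral>s. g x s \<partial>P))"
    if "x \<in> X" for x
    unfolding worst_case_def \<P>_def g_def using f(1)[OF that] by simp
  have attained: "\<exists>\<nu>. (x, \<nu>) \<in> F \<and> sip_objective f r N\<xi> (x, \<nu>) = worst_case h \<P> x"
    if x: "x \<in> X" for x
  proof -
    obtain l \<nu> where l: "0 \<le> l"
      "\<forall>s\<in>\<Xi>. \<forall>j\<in>{1..N\<xi>}. g x s \<le> \<nu> j + l * p_norm p (s - a j)"
      "(SUP P\<in>ambiguity p \<Xi> r (Q x). ereal (\<integral>s. g x s \<partial>P))
        = ereal ((\<Sum>j=1..N\<xi>. f j x * \<nu> j) + r * l)"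
      using worst_case_strong_duality[where u="\<lambda>i. f i x",
          OF p assms(6) cont[OF x] finite_atLeastAtMost f(4,5,3,2)[OF x] assms(14)]
      unfolding Q_def by blast
    define \<nu>' where "\<nu>' = restrict (\<nu>(N\<xi> + 1 := l)) {1..N\<xi> + 1}"
    have \<nu>': "\<nu>' (N\<xi> + 1) = l" "\<And>j. j \<in> {1..N\<xi>} \<Longrightarrow> \<nu>' j = \<nu> j" "\<nu>' \<in> {1..N\<xi> + 1} \<rightarrow>\<^sub>E UNIV"
      unfolding \<nu>'_def by auto
    have "(x, \<nu>') \<in> F" unfolding feas_iff using x l \<nu>' by auto
    moreover have "sip_objective f r N\<xi> (x, \<nu>') = worst_case h \<P> x"
      using l(3) worst[OF x] \<nu>' unfolding sip_objective_def by simp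
    ultimately show ?thesis by blast
  qed
  have bound: "x \<in> X \<and> worst_case h \<P> x \<le> sip_objective f r N\<xi> (x, \<nu>)" if "(x, \<nu>) \<in> F" for x \<nu>
  proof -
    have x: "x \<in> X" and l: "0 \<le> \<nu> (N\<xi> + 1)"
      and c: "\<And>s i. s \<in> \<Xi> \<Longrightarrow> i \<in> {1..N\<xi>} \<Longrightarrow> g x s \<le> \<nu> i + \<nu> (N\<xi> + 1) * p_norm p (s - a i)"
      using that unfolding feas_iff by auto
    have "worst_case h \<P> x \<le> sip_objective f r N\<xi> (x, \<nu>)"
      unfolding worst[OF x] sip_objective_def prod.case
      using expectation_le_dual[where u="\<lambda>i. f i x",
          OF p assms(6) cont[OF x] finite_atLeastAtMost f(4,5,3)[OF x] l c]
        assms(14) unfolding Q_def by (intro SUP_least) simp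
    then show ?thesis using x by simp
  qed
  show ?thesis
    using partial_minimization_equivalence[where v="worst_case h \<P>" and J="sip_objective f r N\<xi>",
        OF attained bound] by blast
qed

end
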